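(* For every integer $k\ge1$, $$G^{k(k-1)\cdots1}_{2\text{-}31}(x)=\begin{cases}x^kC^{k+1}(x),&\text{if }k\ge2,\\ C(x),&\text{if }k=1,\end{cases}$$ where $C^{k+1}(x)=(C(x))^{k+1}$.
   Context: A permutation $\pi=\pi_1\cdots\pi_n$ of $\{1,\dots,n\}$ contains the generalized pattern $2\text{-}31$ if there are indices $i<j<n$ such that $\pi_i\pi_j\pi_{j+1}$ is order-isomorphic to $231$; otherwise it avoids it. A permutation $\pi$ begins with a pattern $p=p_1\cdots p_k$ if $n\ge k$ and $\pi_1\cdots\pi_k$ is order-isomorphic to $p$; by convention, the empty permutation is also regarded as beginning with the pattern $1$ (the case $k=1$). $G^p_q(x)=\sum_{n\ge0}N^p_q(n)x^n$, where $N^p_q(n)$ is the number of permutations of $\{1,\dots,n\}$ that avoid $q$ and begin with $p$. $C(x)=\sum_{n\ge0}C_nx^n=\frac{1-\sqrt{1-4x}}{2x}$ is the generating function of the Catalan numbers $C_n=\frac1{n+1}\binom{2n}{n}$. *)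

theory Defs
  imports
    "HOL-Computational_Algebra.Formal_Power_Series"
    "HOL-Combinatorics.Multiset_Permutations"
begin

text \<open>
  A permutation of \<open>{1..n}\<close> is written in one-line notation, as an element of
  \<^term>\<open>permutations_of_set {1..n} :: nat list set\<close>. List positions are counted from 0.
\<close>

definition order_isomorphic :: "nat list \<Rightarrow> nat list \<Rightarrow> bool" where
  "order_isomorphic xs ys \<longleftrightarrow>
     length xs = length ys \<and>
     (\<forall>i<length xs. \<forall>j<length xs. xs ! i < xs ! j \<longleftrightarrow> ys ! i < ys ! j)"

definition contains_2_31 :: "nat list \<Rightarrow> bool" where
  "contains_2_31 \<pi> \<longleftrightarrow>
     (\<exists>i j. i < j \<and> Suc j < length \<pi> \<and>
        order_isomorphic [\<pi> ! i, \<pi> ! j, \<pi> ! Suc j] [2, 3, 1])"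

text \<open>The second disjunct is the convention that the empty permutation begins with the pattern 1.\<close>

definition begins_with :: "nat list \<Rightarrow> nat list \<Rightarrow> bool" where
  "begins_with p \<pi> \<longleftrightarrow>
     (length p \<le> length \<pi> \<and> order_isomorphic (take (length p) \<pi>) p) \<or>
     (\<pi> = [] \<and> p = [1])"

text \<open>
  The argument \<open>q\<close> is the containment predicate of the pattern to be avoided.
\<close>

definition num_avoid_begin :: "(nat list \<Rightarrow> bool) \<Rightarrow> nat list \<Rightarrow> nat \<Rightarrow> nat" where
  "num_avoid_begin q p n =
     card {\<pi> \<in> permutations_of_set {1..n}. \<not> q \<pi> \<and> begins_with p \<pi>}"

definition gf_avoid_begin :: "(nat list \<Rightarrow> bool) \<Rightarrow> nat list \<Rightarrow> real fps" where
  "gf_avoid_begin q p = Abs_fps (\<lambda>n. real (num_avoid_begin q p n))"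

definition decreasing_pattern :: "nat \<Rightarrow> nat list" where
  "decreasing_pattern k = rev [1..<Suc k]"

definition catalan :: "nat \<Rightarrow> real" where
  "catalan n = 1 / real (n + 1) * real ((2 * n) choose n)"

definition catalan_gf :: "real fps" where
  "catalan_gf = Abs_fps catalan"

end

theory Submission
  imports Defs
begin

unbundle fps_syntax

text \<open>
  Write a permutation as \<open>x # \<sigma>\<close>. It avoids 2-31 iff \<open>\<sigma> = L @ R\<close> with \<open>L < x < R\<close> and
  both \<open>L\<close> and \<open>R\<close> avoid 2-31. Its first \<open>k + 1\<close> entries decrease iff the first \<open>k\<close> entries of
  \<open>L\<close> exist and decrease. So if \<open>A\<^sub>k\<close> counts the avoiders of length at least \<open>k\<close>
  whose first \<open>k\<close> entries decrease, then \<open>A\<^sub>0 = 1 + x A\<^sub>0\<^sup>2\<close> and \<open>A\<^sub>k\<^sub>+\<^sub>1 = x A\<^sub>k A\<^sub>0\<close>. The first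
  equation determines \<open>A\<^sub>0 = C\<close>, and then \<open>A\<^sub>k = x\<^sup>k C\<^sup>k\<^sup>+\<^sup>1\<close>.
\<close>

subsection \<open>Decomposition at the first entry\<close>

lemma order_isomorphic_231_iff:
  "order_isomorphic [a, b, c] [2, 3, 1] \<longleftrightarrow> c < a \<and> a < b"
  unfolding order_isomorphic_def
  by (auto simp: numeral_3_eq_3 less_Suc_eq nth_Cons')

lemma contains_2_31_iff:
  "contains_2_31 xs \<longleftrightarrow>
     (\<exists>i j. i < j \<and> Suc j < length xs \<and> xs ! Suc j < xs ! i \<and> xs ! i < xs ! j)"
  unfolding contains_2_31_def order_isomorphic_231_iff ..

lemma contains_2_31_Nil [simp]: "\<not> contains_2_31 []"
  by (simp add: contains_2_31_iff)

text \<open>An occurrence that uses the first entry must use \<open>x\<close> as its 2, so its 31 is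
  an adjacent pair of \<open>xs\<close> that drops from above \<open>x\<close> to below it;
  \<open>successively\<close> forbids exactly such drops.\<close>

lemma contains_2_31_Cons:
  "contains_2_31 (x # xs) \<longleftrightarrow>
     contains_2_31 xs \<or> \<not> successively (\<lambda>b c. \<not> (c < x \<and> x < b)) xs"
proof
  assume "contains_2_31 (x # xs)"
  then obtain i j where ij: "i < j" "Suc j < length (x # xs)"
    "(x # xs) ! Suc j < (x # xs) ! i" "(x # xs) ! i < (x # xs) ! j"
    unfolding contains_2_31_iff by blast
  from ij obtain j' where [simp]: "j = Suc j'" by (cases j) auto
  show "contains_2_31 xs \<or> \<not> successively (\<lambda>b c. \<not> (c < x \<and> x < b)) xs"
  proof (cases i)
    case 0
    then show ?thesis using ij by (auto simp: successively_conv_nth)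
  next
    case (Suc i')
    then show ?thesis using ij by (auto simp: contains_2_31_iff)
  qed
next
  assume "contains_2_31 xs \<or> \<not> successively (\<lambda>b c. \<not> (c < x \<and> x < b)) xs"
  then show "contains_2_31 (x # xs)"
  proof
    assume "contains_2_31 xs"
    then obtain i j where "i < j" "Suc j < length xs" "xs ! Suc j < xs ! i" "xs ! i < xs ! j"
      unfolding contains_2_31_iff by blast
    then show ?thesis unfolding contains_2_31_iff
      by (intro exI[of _ "Suc i"] exI[of _ "Suc j"]) auto
  next
    assume "\<not> successively (\<lambda>b c. \<not> (c < x \<and> x < b)) xs"
    then obtain j where "Suc j < length xs" "xs ! Suc j < x" "x < xs ! j"
      by (auto simp: successively_conv_nth)
    then show ?thesis unfolding contains_2_31_iff
      by (intro exI[of _ 0] exI[of _ "Suc j"]) auto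
  qed
qed

text \<open>Every entry differs from \<open>x\<close>, so a list with no drop across
  \<open>x\<close> stays above \<open>x\<close> once it is there and splits at its first entry above
  \<open>x\<close>.\<close>

lemma successively_no_crossing_iff_split:
  fixes x :: "'a :: linorder"
  assumes "x \<notin> set xs"
  shows "successively (\<lambda>b c. \<not> (c < x \<and> x < b)) xs \<longleftrightarrow>
           (\<exists>L R. xs = L @ R \<and> (\<forall>y\<in>set L. y < x) \<and> (\<forall>y\<in>set R. x < y))"
proof
  assume "successively (\<lambda>b c. \<not> (c < x \<and> x < b)) xs"
  then show "\<exists>L R. xs = L @ R \<and> (\<forall>y\<in>set L. y < x) \<and> (\<forall>y\<in>set R. x < y)"
    using assms
  proof (induction xs)
    case Nil
    then show ?case by simp
  next
    case (Cons z zs)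
    then obtain L R where LR: "zs = L @ R" "\<forall>y\<in>set L. y < x" "\<forall>y\<in>set R. x < y"
      by (auto simp: successively_Cons)
    show ?case
    proof (cases "z < x")
      case True
      then show ?thesis using LR by (intro exI[of _ "z # L"] exI[of _ R]) auto
    next
      case False
      then have z: "x < z" using Cons.prems by auto
      \<comment> \<open>Otherwise the head of \<open>L\<close>, which is below \<open>x\<close>,
        would directly follow \<open>z\<close>: a forbidden drop.\<close>
      then have "L = []" using Cons.prems(1) LR by (cases L) auto
      then show ?thesis using LR z by (intro exI[of _ "[]"] exI[of _ "z # R"]) auto
    qed
  qed
next
  assume "\<exists>L R. xs = L @ R \<and> (\<forall>y\<in>set L. y < x) \<and> (\<forall>y\<in>set R. x < y)"
  then obtain L R where LR: "xs = L @ R" "\<forall>y\<in>set L. y < x" "\<forall>y\<in>set R. x < y"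
    by blast
  have "\<not> (xs ! Suc i < x \<and> x < xs ! i)" if "Suc i < length xs" for i
  proof (cases "Suc i < length L")
    case True
    then have "xs ! i \<in> set L" using LR(1) by (simp add: nth_append)
    with LR(2) show ?thesis using order.asym by blast
  next
    case False
    then have "xs ! Suc i = R ! (Suc i - length L)" "Suc i - length L < length R"
      using LR(1) that by (simp_all add: nth_append)
    then have "xs ! Suc i \<in> set R" by simp
    with LR(3) show ?thesis using order.asym by blast
  qed
  then show "successively (\<lambda>b c. \<not> (c < x \<and> x < b)) xs"
    by (simp add: successively_conv_nth)
qed

text \<open>Induction on \<open>L\<close>: all of \<open>R\<close> exceeds the new head
  \<open>y\<close>, so no drop across \<open>y\<close> occurs inside \<open>R\<close> or at the
  junction.\<close>

lemma contains_2_31_append: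
  assumes "\<And>y z. y \<in> set L \<Longrightarrow> z \<in> set R \<Longrightarrow> y < z"
  shows "contains_2_31 (L @ R) \<longleftrightarrow> contains_2_31 L \<or> contains_2_31 R"
  using assms
proof (induction L)
  case Nil
  then show ?case by simp
next
  case (Cons y L)
  have R: "y < z" if "z \<in> set R" for z using Cons.prems that by simp
  have "successively (\<lambda>b c. \<not> (c < y \<and> y < b)) R"
    using R by (auto simp: successively_conv_nth dest!: nth_mem dest: order.asym)
  moreover have "\<not> hd R < y" if "R \<noteq> []" using R[of "hd R"] that by auto
  ultimately show ?case
    using Cons by (auto simp: contains_2_31_Cons successively_append_iff)
qed

lemma contains_2_31_Cons_append:
  assumes "\<forall>y\<in>set L. y < x" "\<forall>y\<in>set R. x < y"
  shows "contains_2_31 (x # L @ R) \<longleftrightarrow> contains_2_31 L \<or> contains_2_31 R"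
proof -
  have "successively (\<lambda>b c. \<not> (c < x \<and> x < b)) (L @ R)"
    using assms by (subst successively_no_crossing_iff_split) auto
  moreover have "contains_2_31 (L @ R) \<longleftrightarrow> contains_2_31 L \<or> contains_2_31 R"
    using assms by (intro contains_2_31_append) (auto intro: less_trans)
  ultimately show ?thesis by (simp add: contains_2_31_Cons)
qed

section \<open>Decreasing prefixes and the decreasing pattern\<close>

definition begins_decreasing :: "nat \<Rightarrow> 'a :: linorder list \<Rightarrow> bool" where
  "begins_decreasing k xs \<longleftrightarrow> k \<le> length xs \<and> sorted_wrt (>) (take k xs)"

lemma begins_decreasing_0 [simp]: "begins_decreasing 0 xs"
  by (simp add: begins_decreasing_def)

text \<open>A decreasing prefix cannot reach into \<open>R\<close>, whose entries exceed
  \<open>x\<close>, so its part after \<open>x\<close> lies within \<open>L\<close>.\<close>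

lemma begins_decreasing_Cons_append:
  assumes "\<forall>y\<in>set L. y < x" "\<forall>y\<in>set R. x < y"
  shows "begins_decreasing (Suc k) (x # L @ R) \<longleftrightarrow> begins_decreasing k L"
proof (cases "k \<le> length L")
  case True
  then show ?thesis using assms
    by (auto simp: begins_decreasing_def dest!: in_set_takeD)
next
  case False
  have "\<not> begins_decreasing (Suc k) (x # L @ R)"
  proof
    assume *: "begins_decreasing (Suc k) (x # L @ R)"
    then have "take (k - length L) R \<noteq> []"
      using False by (auto simp: begins_decreasing_def)
    then obtain y where y: "y \<in> set (take (k - length L) R)"
      by (meson last_in_set)
    with * have "y < x" by (auto simp: begins_decreasing_def)
    moreover have "x < y" using y assms(2) by (auto dest: in_set_takeD)
    ultimately show False by simp
  qed
  with False show ?thesis by (simp add: begins_decreasing_def)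
qed

lemma nth_decreasing_pattern: "i < k \<Longrightarrow> decreasing_pattern k ! i = k - i"
  unfolding decreasing_pattern_def by (simp add: rev_nth del: upt_Suc)

lemma length_decreasing_pattern [simp]: "length (decreasing_pattern k) = k"
  by (simp add: decreasing_pattern_def)

lemma order_isomorphic_decreasing_pattern:
  "order_isomorphic xs (decreasing_pattern (length xs)) \<longleftrightarrow> sorted_wrt (>) xs"
proof
  assume *: "order_isomorphic xs (decreasing_pattern (length xs))"
  show "sorted_wrt (>) xs" unfolding sorted_wrt_iff_nth_less
  proof (intro allI impI)
    fix i j assume "i < j" "j < length xs"
    with * show "xs ! j < xs ! i"
      by (auto simp: order_isomorphic_def nth_decreasing_pattern)
  qed
next
  assume *: "sorted_wrt (>) xs"
  have "xs ! i < xs ! j \<longleftrightarrow> j < i" if "i < length xs" "j < length xs" for i j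
    using sorted_wrt_nth_less[OF *, of i j] sorted_wrt_nth_less[OF *, of j i] that
    by (cases i j rule: linorder_cases) auto
  then show "order_isomorphic xs (decreasing_pattern (length xs))"
    by (auto simp: order_isomorphic_def nth_decreasing_pattern)
qed

lemma begins_with_decreasing_pattern:
  "begins_with (decreasing_pattern k) xs \<longleftrightarrow> begins_decreasing k xs \<or> xs = [] \<and> k = 1"
proof -
  have "decreasing_pattern k = [1] \<longleftrightarrow> k = 1"
    by (auto simp: decreasing_pattern_def dest: arg_cong[of _ _ length])
  moreover have "order_isomorphic (take k xs) (decreasing_pattern k) \<longleftrightarrow>
      sorted_wrt (>) (take k xs)" if "k \<le> length xs"
    using order_isomorphic_decreasing_pattern[of "take k xs"] that by simp
  ultimately show ?thesis
    by (auto simp: begins_with_def begins_decreasing_def)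
qed

subsection \<open>Counting\<close>

text \<open>The start \<open>a\<close> is a parameter because splitting at the first entry puts
  \<open>R\<close> on an interval with a different start.\<close>

definition avoiders :: "nat \<Rightarrow> nat \<Rightarrow> nat \<Rightarrow> nat list set" where
  "avoiders k a n =
     {xs \<in> permutations_of_set {a..<a + n}. \<not> contains_2_31 xs \<and> begins_decreasing k xs}"

lemma avoiders_iff:
  "xs \<in> avoiders k a n \<longleftrightarrow>
     distinct xs \<and> set xs = {a..<a + n} \<and> \<not> contains_2_31 xs \<and> begins_decreasing k xs"
  by (auto simp: avoiders_def permutations_of_set_def)

lemma finite_avoiders: "finite (avoiders k a n)"
  unfolding avoiders_def by simp

lemma avoiders_0: "avoiders k a 0 = (if k = 0 then {[]} else {})"
  by (auto simp: avoiders_iff begins_decreasing_def)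

text \<open>Here \<open>m\<close> is the number of values below the first entry. The assumption
  covers two recursions at once: with no prefix condition none is passed to \<open>L\<close>, and a
  decreasing prefix of length \<open>Suc k\<close> leaves one of length \<open>k\<close> in
  \<open>L\<close>.\<close>

lemma avoiders_Suc:
  assumes k: "k' = 0 \<and> k = 0 \<or> k' = Suc k"
  shows "avoiders k' a (Suc n) =
    (\<Union>m\<le>n. (\<lambda>(L, R). (a + m) # L @ R) ` (avoiders k a m \<times> avoiders 0 (a + m + 1) (n - m)))"
proof (intro equalityI subsetI)
  fix xs assume xs: "xs \<in> avoiders k' a (Suc n)"
  then obtain x ys where [simp]: "xs = x # ys"
    by (cases xs) (auto simp: avoiders_iff)
  from xs have d: "distinct (x # ys)" and s: "insert x (set ys) = {a..<a + Suc n}"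
    and av: "\<not> contains_2_31 (x # ys)" and b: "begins_decreasing k' (x # ys)"
    by (auto simp: avoiders_iff)
  from d av obtain L R where [simp]: "ys = L @ R"
    and LR: "\<forall>y\<in>set L. y < x" "\<forall>y\<in>set R. x < y"
    using successively_no_crossing_iff_split[of x ys] by (auto simp: contains_2_31_Cons)
  have "x \<in> {a..<a + Suc n}" using s by blast
  then have x: "a \<le> x" "x \<le> a + n" by auto
  then obtain m where m: "x = a + m" "m \<le> n"
    by (metis nat_add_left_cancel_le le_Suc_ex)
  \<comment> \<open>Taken pointwise, the set equation becomes linear arithmetic: \<open>L\<close>
    must hold exactly the values below \<open>x\<close>, and \<open>R\<close> those above.\<close>
  have mem: "y \<in> set L \<or> y = x \<or> y \<in> set R \<longleftrightarrow> a \<le> y \<and> y \<le> a + n" for y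
    using arg_cong[OF s, of "\<lambda>S. y \<in> S"] by auto
  have "y \<in> set L \<longleftrightarrow> a \<le> y \<and> y < a + m" for y
    using mem[of y] bspec[OF LR(1), of y] bspec[OF LR(2), of y] m by linarith
  then have "set L = {a..<a + m}" by (simp add: set_eq_iff)
  moreover have "y \<in> set R \<longleftrightarrow> a + m + 1 \<le> y \<and> y < a + m + 1 + (n - m)" for y
    using mem[of y] bspec[OF LR(1), of y] bspec[OF LR(2), of y] m by linarith
  then have "set R = {a + m + 1..<a + m + 1 + (n - m)}" by (simp add: set_eq_iff)
  moreover have "begins_decreasing k L"
    using k b begins_decreasing_Cons_append[OF LR, of k] by (elim disjE conjE) simp_all
  ultimately have "L \<in> avoiders k a m" "R \<in> avoiders 0 (a + m + 1) (n - m)"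
    using d av contains_2_31_Cons_append[OF LR] by (auto simp: avoiders_iff)
  then have "xs \<in> (\<lambda>(L, R). (a + m) # L @ R) `
      (avoiders k a m \<times> avoiders 0 (a + m + 1) (n - m))"
    using m by (intro image_eqI[of _ _ "(L, R)"]) auto
  then show "xs \<in> (\<Union>m\<le>n. (\<lambda>(L, R). (a + m) # L @ R) `
      (avoiders k a m \<times> avoiders 0 (a + m + 1) (n - m)))"
    using m(2) by blast
next
  fix xs assume "xs \<in> (\<Union>m\<le>n. (\<lambda>(L, R). (a + m) # L @ R) `
      (avoiders k a m \<times> avoiders 0 (a + m + 1) (n - m)))"
  then obtain m L R where m: "m \<le> n" and xs: "xs = (a + m) # L @ R"
    and L: "L \<in> avoiders k a m" and R: "R \<in> avoiders 0 (a + m + 1) (n - m)"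
    by auto
  have LR: "\<forall>y\<in>set L. y < a + m" "\<forall>y\<in>set R. a + m < y"
    using L R by (auto simp: avoiders_iff)
  have "set xs = {a..<a + Suc n}"
  proof -
    have "insert x ({a..<x} \<union> {x + 1..<a + Suc n}) = {a..<a + Suc n}" if "x \<in> {a..<a + Suc n}" for x
      using that by auto
    from this[of "a + m"] show ?thesis
      using L R m by (simp add: xs avoiders_iff)
  qed
  moreover have "distinct xs"
    using L R LR by (auto simp: xs avoiders_iff)
  moreover have "\<not> contains_2_31 xs"
    using contains_2_31_Cons_append[OF LR] L R by (auto simp: xs avoiders_iff)
  moreover have "begins_decreasing k' xs"
    using begins_decreasing_Cons_append[OF LR, of k] k L by (auto simp: xs avoiders_iff)
  ultimately show "xs \<in> avoiders k' a (Suc n)" by (simp add: avoiders_iff)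
qed

text \<open>The first entry determines \<open>m\<close>, so the union is disjoint; \<open>L\<close>
  has length \<open>m\<close>, so the split point is known and each map is injective.\<close>

lemma card_avoiders_Suc:
  assumes "k' = 0 \<and> k = 0 \<or> k' = Suc k"
  shows "card (avoiders k' a (Suc n)) =
    (\<Sum>m\<le>n. card (avoiders k a m) * card (avoiders 0 (a + m + 1) (n - m)))"
proof -
  let ?f = "\<lambda>m (L, R). (a + m) # L @ R"
  let ?P = "\<lambda>m. avoiders k a m \<times> avoiders 0 (a + m + 1) (n - m)"
  have "length L = m" if "L \<in> avoiders k a m" for L m
    using that by (metis avoiders_iff distinct_card card_atLeastLessThan add_diff_cancel_left')
  then have inj: "inj_on (?f m) (?P m)" for m
    by (intro inj_onI) auto
  have "card (\<Union>m\<le>n. ?f m ` ?P m) = (\<Sum>m\<le>n. card (?f m ` ?P m))"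
    by (intro card_UN_disjoint) (auto simp: finite_avoiders)
  also have "\<dots> = (\<Sum>m\<le>n. card (avoiders k a m) * card (avoiders 0 (a + m + 1) (n - m)))"
    by (simp only: card_image[OF inj] card_cartesian_product)
  finally show ?thesis unfolding avoiders_Suc[OF assms] .
qed

text \<open>The recurrence for the cardinalities has the same shape for every start, so strong
  induction on \<open>n\<close> replaces an explicit relabelling.\<close>

lemma card_avoiders_shift: "card (avoiders k a n) = card (avoiders k b n)"
proof (induction n arbitrary: k a b rule: less_induct)
  case (less n)
  show ?case
  proof (cases n)
    case 0
    then show ?thesis by (simp add: avoiders_0)
  next
    case (Suc n')
    \<comment> \<open>Truncated subtraction lets \<open>k - 1\<close> serve both cases, as
      \<open>0 - 1 = 0\<close>.\<close>
    have k: "k = 0 \<and> k - 1 = 0 \<or> k = Suc (k - 1)" by auto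
    show ?thesis unfolding Suc card_avoiders_Suc[OF k]
      by (intro sum.cong refl arg_cong2[of _ _ _ _ "(*)"] less) (auto simp: Suc)
  qed
qed

section \<open>Passage to generating functions\<close>

definition avoiders_gf :: "nat \<Rightarrow> real fps" where
  "avoiders_gf k = Abs_fps (\<lambda>n. real (card (avoiders k 1 n)))"

lemma avoiders_gf_rec:
  assumes "k' = 0 \<and> k = 0 \<or> k' = Suc k"
  shows "avoiders_gf k' = (if k' = 0 then 1 else 0) + fps_X * (avoiders_gf k * avoiders_gf 0)"
proof (rule fps_ext)
  fix n
  show "avoiders_gf k' $ n =
      ((if k' = 0 then 1 else 0) + fps_X * (avoiders_gf k * avoiders_gf 0)) $ n"
  proof (cases n)
    case 0
    then show ?thesis by (auto simp: avoiders_gf_def avoiders_0)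
  next
    case (Suc n')
    have "card (avoiders k' 1 n) =
        (\<Sum>m\<le>n'. card (avoiders k 1 m) * card (avoiders 0 1 (n' - m)))"
      unfolding Suc card_avoiders_Suc[OF assms]
      by (intro sum.cong refl arg_cong2[of _ _ _ _ "(*)"] card_avoiders_shift)
    then have "avoiders_gf k' $ n = (avoiders_gf k * avoiders_gf 0) $ n'"
      by (simp add: avoiders_gf_def fps_mult_nth atLeast0AtMost)
    then show ?thesis by (simp add: Suc)
  qed
qed

text \<open>The extra 1 for \<open>k = 1\<close> is the empty permutation, which begins with the
  pattern 1 by convention but is not in \<open>avoiders 1 1 0\<close>.\<close>

lemma gf_avoid_begin_decreasing:
  "gf_avoid_begin contains_2_31 (decreasing_pattern k) = avoiders_gf k + (if k = 1 then 1 else 0)"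
proof (rule fps_ext)
  fix n
  let ?S = "{xs \<in> permutations_of_set {1..n}.
    \<not> contains_2_31 xs \<and> begins_with (decreasing_pattern k) xs}"
  have "?S = avoiders k 1 n \<union> (if k = 1 \<and> n = 0 then {[]} else {})"
    by (auto simp: avoiders_def begins_with_decreasing_pattern
        atLeastLessThanSuc_atLeastAtMost permutations_of_set_def)
  then have "card ?S = card (avoiders k 1 n) + (if k = 1 \<and> n = 0 then 1 else 0)"
    by (simp add: avoiders_0)
  then show "gf_avoid_begin contains_2_31 (decreasing_pattern k) $ n =
      (avoiders_gf k + (if k = 1 then 1 else 0)) $ n"
    by (simp add: gf_avoid_begin_def num_avoid_begin_def avoiders_gf_def)
qed

subsection \<open>The Catalan generating function\<close>

text \<open>Two absorption identities lead from \<open>(2 * n + 2) choose Suc n\<close> through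
  \<open>(2 * n + 1) choose n\<close> to the central binomial coefficient for
  \<open>n\<close>.\<close>

lemma catalan_Suc: "real (n + 2) * catalan (Suc n) = real (4 * n + 2) * catalan n"
proof -
  have "Suc n * ((2 * n + 2) choose Suc n) = (2 * n + 2) * ((2 * n + 1) choose n)"
    using Suc_times_binomial_eq[of "2 * n + 1" n] by (simp add: mult.commute)
  moreover have "Suc n * ((2 * n + 1) choose n) = (2 * n + 1) * ((2 * n) choose n)"
    using Suc_times_binomial_eq[of "2 * n" n] binomial_symmetric[of n "2 * n + 1"]
    by (simp add: mult.commute)
  ultimately have "Suc n * (Suc n * ((2 * n + 2) choose Suc n)) =
      Suc n * ((4 * n + 2) * ((2 * n) choose n))"
    by (simp only: mult.left_commute[of "Suc n" "2 * n + 2"]) (simp add: algebra_simps)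
  then have "Suc n * ((2 * n + 2) choose Suc n) = (4 * n + 2) * ((2 * n) choose n)"
    by (simp only: mult_cancel1) simp
  then have "real (Suc n) * real ((2 * n + 2) choose Suc n) =
      real (4 * n + 2) * real ((2 * n) choose n)"
    by (metis of_nat_mult)
  moreover have "real (n + 2) * (1 / real (Suc n + 1) * b') = real (4 * n + 2) * (1 / real (n + 1) * b)"
    if "real (Suc n) * b' = real (4 * n + 2) * b" for b b' :: real
  proof -
    have "real (n + 2) * (1 / real (Suc n + 1) * b') = b'" by simp
    also have "b' = real (4 * n + 2) * b / real (Suc n)"
      using that by (simp add: eq_divide_eq mult.commute)
    finally show ?thesis by simp
  qed
  ultimately show ?thesis
    unfolding catalan_def by (simp only: mult_Suc_right add_2_eq_Suc' add_2_eq_Suc)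
qed

text \<open>The equation gives a first-order recurrence whose factor \<open>n - 1\<close> vanishes
  at \<open>n = 1\<close>, which kills all coefficients from index 2 on.\<close>

lemma fps_deriv_unique_1_minus_4X:
  fixes F :: "real fps"
  assumes "(1 - 4 * fps_X) * fps_deriv F = - 4 * F" "F $ 0 = 1"
  shows "F = 1 - 4 * fps_X"
proof -
  have rec: "real (Suc n) * F $ Suc n = 4 * (real n - 1) * F $ n" for n
    using arg_cong[OF assms(1), of "\<lambda>f. f $ n"]
    by (cases n) (auto simp: algebra_simps numeral_fps_const)
  have F1: "F $ 1 = - 4" using rec[of 0] assms(2) by simp
  have F2: "F $ Suc (Suc n) = 0" for n
  proof (induction n)
    case 0
    then show ?case using rec[of 1] by simp
  next
    case (Suc n)
    then have "real (Suc (Suc (Suc n))) * F $ Suc (Suc (Suc n)) = 0"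
      using rec[of "Suc (Suc n)"] by simp
    then show ?case by (metis mult_eq_0_iff of_nat_eq_0_iff nat.distinct(1))
  qed
  show ?thesis
  proof (rule fps_ext)
    fix n
    show "F $ n = (1 - 4 * fps_X) $ n"
      using assms(2) F1 F2
      by (cases n rule: nat.exhaust; cases "n - 1") (auto simp: numeral_fps_const)
  qed
qed

lemma catalan_gf_quadratic: "catalan_gf = 1 + fps_X * catalan_gf ^ 2"
proof -
  let ?C = catalan_gf
  \<comment> \<open>By the closed form of the Catalan series, \<open>F\<close> should be the square
    root of \<open>1 - 4 * fps_X\<close>.\<close>
  define F where "F = 1 - 2 * fps_X * ?C"
  \<comment> \<open>The coefficient at \<open>Suc m\<close> is the recurrence
    \<open>catalan_Suc\<close>.\<close>
  have ode: "fps_X * (1 - 4 * fps_X) * fps_deriv ?C + (1 - 2 * fps_X) * ?C = 1"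
  proof (rule fps_ext)
    fix n
    show "(fps_X * (1 - 4 * fps_X) * fps_deriv ?C + (1 - 2 * fps_X) * ?C) $ n = 1 $ n"
    proof (cases n)
      case 0
      then show ?thesis by (simp add: catalan_gf_def catalan_def mult.assoc)
    next
      case (Suc m)
      then show ?thesis using catalan_Suc[of m]
        by (cases m) (auto simp: catalan_gf_def algebra_simps numeral_fps_const)
    qed
  qed
  have "(1 - 4 * fps_X) * fps_deriv F = - 2 * F"
  proof -
    have "fps_deriv F = - 2 * ?C - 2 * fps_X * fps_deriv ?C"
      by (simp add: F_def algebra_simps)
    then have "(1 - 4 * fps_X) * fps_deriv F + 2 * F =
        2 - 2 * (fps_X * (1 - 4 * fps_X) * fps_deriv ?C + (1 - 2 * fps_X) * ?C)"
      unfolding F_def by (simp add: algebra_simps)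
    then show ?thesis by (simp add: ode eq_neg_iff_add_eq_0)
  qed
  \<comment> \<open>Multiplying by \<open>2 * F\<close> turns the equation for \<open>F\<close> into
    one for the derivative of \<open>F ^ 2\<close>.\<close>
  then have "2 * F * ((1 - 4 * fps_X) * fps_deriv F) = 2 * F * (- 2 * F)"
    by (rule arg_cong)
  then have "(1 - 4 * fps_X) * fps_deriv (F ^ 2) = - 4 * F ^ 2"
    by (simp add: power2_eq_square algebra_simps)
  moreover have "(F ^ 2) $ 0 = 1" by (simp add: F_def power2_eq_square mult.assoc)
  ultimately have "F ^ 2 = 1 - 4 * fps_X" by (rule fps_deriv_unique_1_minus_4X)
  then have "4 * fps_X * (?C - (1 + fps_X * ?C ^ 2)) = 0"
    by (simp add: F_def power2_eq_square algebra_simps)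
  then show ?thesis by simp
qed

text \<open>The difference of the two equations factors through \<open>A - B\<close>, and the
  cofactor has constant term 1, hence is nonzero in an integral domain.\<close>

lemma fps_quadratic_unique:
  fixes A B :: "'a :: idom fps"
  assumes "A = 1 + fps_X * A ^ 2" "B = 1 + fps_X * B ^ 2"
  shows "A = B"
proof -
  have "(A - B) * (1 - fps_X * (A + B)) = (A - B) - ((1 + fps_X * A ^ 2) - (1 + fps_X * B ^ 2))"
    by (simp add: power2_eq_square algebra_simps)
  also have "\<dots> = 0" using assms by simp
  finally have "(A - B) * (1 - fps_X * (A + B)) = 0" .
  moreover have "(1 - fps_X * (A + B)) $ 0 \<noteq> 0" by simp
  then have "1 - fps_X * (A + B) \<noteq> 0" by (metis fps_zero_nth)
  ultimately show ?thesis by simp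
qed

lemma avoiders_gf_0: "avoiders_gf 0 = catalan_gf"
proof (rule fps_quadratic_unique)
  show "avoiders_gf 0 = 1 + fps_X * avoiders_gf 0 ^ 2"
    unfolding power2_eq_square by (rule avoiders_gf_rec[of 0 0, simplified])
qed (rule catalan_gf_quadratic)

lemma avoiders_gf_eq: "avoiders_gf k = fps_X ^ k * catalan_gf ^ (k + 1)"
proof (induction k)
  case 0
  then show ?case by (simp add: avoiders_gf_0)
next
  case (Suc k)
  then show ?case using avoiders_gf_rec[of "Suc k" k]
    by (simp add: avoiders_gf_0 algebra_simps)
qed

theorem proposition8:
  fixes k :: nat
  assumes "k \<ge> 1"
  shows "gf_avoid_begin contains_2_31 (decreasing_pattern k) =
           (if k \<ge> 2 then fps_X ^ k * catalan_gf ^ (k + 1) else catalan_gf)"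
proof (cases "k = 1")
  case True
  \<comment> \<open>The conventional 1 and \<open>fps_X * catalan_gf ^ 2\<close> add up to
    \<open>catalan_gf\<close> by the quadratic equation.\<close>
  then show ?thesis
    using catalan_gf_quadratic
    by (simp add: gf_avoid_begin_decreasing avoiders_gf_eq numeral_2_eq_2 add.commute)
next
  case False
  then show ?thesis using assms by (simp add: gf_avoid_begin_decreasing avoiders_gf_eq)
qed

end
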